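(* Let $f_1,f_2$ be convex, $g_0$ componentwise convex, $h_1,h_2$ affine, and $g(x)=\max\{0,g_0(x)\}^2$ (componentwise), and consider the problem $$\min_{x,z}\ f_1(x)+f_2(z)\quad\text{s.t.}\quad g(x)=0,\quad h_1(x)+h_2(z)=0,$$ under the standing assumptions listed in the context. Let $\rho>0$ and let $(x^k,z^k,\mu^k,\lambda^k)_{k\ge 0}$ be any sequence generated by the iteration described in the context. Let $f^*$ be the optimal value of the problem, $f^k=f_1(x^k)+f_2(z^k)$, $r_g^k=g(x^k)$ and $r_h^k=h_1(x^k)+h_2(z^k)$. Then $$\lim_{k\to\infty} r_g^k=0,\qquad \lim_{k\to\infty} r_h^k=0,\qquad \lim_{k\to\infty} f^k=f^*.$$
   Context: Data: $f_1:\mathbb{R}^{n_1}\to\mathbb{R}\cup\{\infty\}$ and $f_2:\mathbb{R}^{n_2}\to\mathbb{R}\cup\{\infty\}$ are convex; $g_0:\mathbb{R}^{n_1}\to\mathbb{R}^p$ is convex in every component; $h_1:\mathbb{R}^{n_1}\to\mathbb{R}^m$ and $h_2:\mathbb{R}^{n_2}\to\mathbb{R}^m$ are affine. Define $g:\mathbb{R}^{n_1}\to\mathbb{R}^p$ by $g(x)=\max\{0,g_0(x)\}^2$, maximum and square taken componentwise. $\|\cdot\|$ is the Euclidean norm. Problem: minimize $f_1(x)+f_2(z)$ over $(x,z)$ subject to $g(x)=0$ and $h_1(x)+h_2(z)=0$. Augmented Lagrangian, for $\rho\ge 0$, $\mu\in\mathbb{R}^p$, $\lambda\in\mathbb{R}^m$: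 $$L_\rho(x,z,\mu,\lambda)=f_1(x)+f_2(z)+\tfrac{\rho}{2}\|g(x)\|^2+\mu^\top g(x)+\tfrac{\rho}{2}\|h_1(x)+h_2(z)\|^2+\lambda^\top(h_1(x)+h_2(z)).$$ $L_0$ (the case $\rho=0$) is the ordinary Lagrangian. Standing assumptions: the problem is feasible with finite optimal value $f^*$, attained at some feasible $(x^*,z^* )$, and strong duality holds with optimal dual variables $\mu^*\in\mathbb{R}^p$, $\lambda^*\in\mathbb{R}^m$, i.e. $L_0(x^*,z^*,\mu^*,\lambda^* )\le L_0(x,z,\mu^*,\lambda^* )$ for all $x\in\mathbb{R}^{n_1}$, $z\in\mathbb{R}^{n_2}$. Iteration (for a fixed constant $\rho>0$): start with $x^0=0$, $z^0=0$, $\mu^0=0$, $\lambda^0=0$; for $k=0,1,2,\ldots$ 1. $x^{k+1}\in\operatorname{argmin}_x L_\rho(x,z^k,\mu^k,\lambda^k)$, where terms depending only on $z^k$ (in particular the constant $f_2(z^k)$, which could be $\infty$ for $k=0$) are disregarded in the minimization over $x$; 2. $z^{k+1}\in\operatorname{argmin}_z L_\rho(x^{k+1},z,\mu^k,\lambda^k)$; 3. $\mu^{k+1}=\mu^k+\rho\, g(x^{k+1})$; 4. $\lambda^{k+1}=\lambda^k+\rho\,(h_1(x^{k+1})+h_2(z^{k+1}))$. The minimizers in steps 1 and 2 are assumed to exist (they need not be unique; any choice is allowed). *)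

theory Defs
  imports "HOL-Analysis.Analysis"
begin

text \<open>Functions into \<open>\<real> \<union> {\<infinity>}\<close> are modelled as \<open>ereal\<close>-valued functions that never take the
  value \<open>-\<infinity>\<close>. The library's \<open>convex_on\<close> only covers real-valued functions; the inequality
  is meaningful at zero weights because \<open>0 * \<infinity> = 0\<close> in \<open>ereal\<close>.\<close>

definition ext_convex :: "('a::real_vector \<Rightarrow> ereal) \<Rightarrow> bool" where
  "ext_convex f \<longleftrightarrow>
     (\<forall>x. f x \<noteq> -\<infinity>) \<and>
     (\<forall>x y u v. 0 \<le> u \<longrightarrow> 0 \<le> v \<longrightarrow> u + v = 1 \<longrightarrow>
        f (u *\<^sub>R x + v *\<^sub>R y) \<le> ereal u * f x + ereal v * f y)"

definition affine_map :: "(real ^ 'n \<Rightarrow> real ^ 'm) \<Rightarrow> bool" where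
  "affine_map h \<longleftrightarrow> (\<exists>A b. \<forall>x. h x = A *v x + b)"

definition feasible_set ::
  "('a \<Rightarrow> real ^ 'p) \<Rightarrow> ('a \<Rightarrow> real ^ 'm) \<Rightarrow> ('b \<Rightarrow> real ^ 'm) \<Rightarrow> ('a \<times> 'b) set" where
  "feasible_set g h1 h2 = {(x, z). g x = 0 \<and> h1 x + h2 z = 0}"

definition opt_value ::
  "('a \<Rightarrow> ereal) \<Rightarrow> ('b \<Rightarrow> ereal) \<Rightarrow>
   ('a \<Rightarrow> real ^ 'p) \<Rightarrow> ('a \<Rightarrow> real ^ 'm) \<Rightarrow> ('b \<Rightarrow> real ^ 'm) \<Rightarrow> ereal" where
  "opt_value f1 f2 g h1 h2 = (INF (x, z)\<in>feasible_set g h1 h2. f1 x + f2 z)"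

definition aug_lagrangian ::
  "('a \<Rightarrow> ereal) \<Rightarrow> ('b \<Rightarrow> ereal) \<Rightarrow>
   ('a \<Rightarrow> real ^ 'p) \<Rightarrow> ('a \<Rightarrow> real ^ 'm) \<Rightarrow> ('b \<Rightarrow> real ^ 'm) \<Rightarrow>
   real \<Rightarrow> 'a \<Rightarrow> 'b \<Rightarrow> real ^ 'p \<Rightarrow> real ^ 'm \<Rightarrow> ereal" where
  "aug_lagrangian f1 f2 g h1 h2 \<rho> x z \<mu> \<nu> =
     f1 x + f2 z +
     ereal (\<rho> / 2 * (norm (g x))\<^sup>2 + \<mu> \<bullet> g x +
            \<rho> / 2 * (norm (h1 x + h2 z))\<^sup>2 + \<nu> \<bullet> (h1 x + h2 z))"

text \<open>In the \<open>x\<close>-update the constant \<open>f2 (z k)\<close> may be \<open>\<infinity>\<close> (for \<open>k = 0\<close>), which would make every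
  point a minimizer; it is dropped by taking the Lagrangian with \<open>f2\<close> replaced by \<open>0\<close>.\<close>

definition admm_iterates ::
  "(real ^ 'n1 \<Rightarrow> ereal) \<Rightarrow> (real ^ 'n2 \<Rightarrow> ereal) \<Rightarrow>
   (real ^ 'n1 \<Rightarrow> real ^ 'p) \<Rightarrow> (real ^ 'n1 \<Rightarrow> real ^ 'm) \<Rightarrow> (real ^ 'n2 \<Rightarrow> real ^ 'm) \<Rightarrow> real \<Rightarrow>
   (nat \<Rightarrow> real ^ 'n1) \<Rightarrow> (nat \<Rightarrow> real ^ 'n2) \<Rightarrow> (nat \<Rightarrow> real ^ 'p) \<Rightarrow> (nat \<Rightarrow> real ^ 'm) \<Rightarrow> bool"
where
  "admm_iterates f1 f2 g h1 h2 \<rho> x z \<mu> \<nu> \<longleftrightarrow>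
     x 0 = 0 \<and> z 0 = 0 \<and> \<mu> 0 = 0 \<and> \<nu> 0 = 0 \<and>
     (\<forall>k.
        is_arg_min (\<lambda>y. aug_lagrangian f1 (\<lambda>_. 0) g h1 h2 \<rho> y (z k) (\<mu> k) (\<nu> k))
          (\<lambda>_. True) (x (Suc k)) \<and>
        is_arg_min (\<lambda>w. aug_lagrangian f1 f2 g h1 h2 \<rho> (x (Suc k)) w (\<mu> k) (\<nu> k))
          (\<lambda>_. True) (z (Suc k)) \<and>
        \<mu> (Suc k) = \<mu> k + \<rho> *\<^sub>R g (x (Suc k)) \<and>
        \<nu> (Suc k) = \<nu> k + \<rho> *\<^sub>R (h1 (x (Suc k)) + h2 (z (Suc k))))"

end

theory Submission
  imports Defs
begin

text \<open>Since \<open>\<mu>\<close> stays nonnegative and \<open>g\<close> is nonnegative and componentwise convex, the \<open>x\<close>-update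
  still satisfies the first-order inequality one has for affine constraints: comparing the minimizer
  with points on a segment only needs an upper bound for the penalty that is quadratic in the step
  length, so neither subgradients nor differentiability of \<open>g\<close> enter. Combined with the saddle
  inequality, the two update inequalities show that
  \<open>\<parallel>\<mu> - \<mu>s\<parallel>\<^sup>2 + \<parallel>\<nu> - \<nu>s\<parallel>\<^sup>2 + \<rho>\<^sup>2 \<parallel>h2 z - h2 zs\<parallel>\<^sup>2\<close> decreases by at least \<open>\<rho>\<^sup>2\<close> times the
  squared residuals from the second step on. Hence the residuals vanish, the multipliers stay
  bounded, and both bounds on \<open>f\<^sup>k - f\<^sup>*\<close> tend to zero.\<close>

section \<open>Null sequences and Lyapunov descent\<close>

lemma tendsto_inner_bounded_0:
  fixes a b :: "nat \<Rightarrow> 'a::real_inner"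
  assumes "\<And>k. norm (a k) \<le> M" and "b \<longlonglongrightarrow> 0"
  shows "(\<lambda>k. a k \<bullet> b k) \<longlonglongrightarrow> 0"
proof (rule Lim_null_comparison)
  show "\<forall>\<^sub>F k in sequentially. norm (a k \<bullet> b k) \<le> M * norm (b k)"
  proof (intro always_eventually allI)
    fix k
    have "norm (a k \<bullet> b k) \<le> norm (a k) * norm (b k)"
      by (simp add: Cauchy_Schwarz_ineq2)
    also have "\<dots> \<le> M * norm (b k)"
      by (intro mult_right_mono assms) simp
    finally show "norm (a k \<bullet> b k) \<le> M * norm (b k)" .
  qed
  show "(\<lambda>k. M * norm (b k)) \<longlonglongrightarrow> 0"
    using tendsto_mult_right_zero[OF tendsto_norm_zero[OF assms(2)]] .
qed

text \<open>Being decreasing and bounded below, \<open>V\<close> converges, so the decrements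
  \<open>V k - V (Suc k)\<close> that dominate \<open>e k\<close> tend to 0.\<close>

lemma Lyapunov_descent:
  fixes V e :: "nat \<Rightarrow> real"
  assumes descent: "\<And>k. V (Suc k) + e k \<le> V k" and "\<And>k. 0 \<le> V k" and "\<And>k. 0 \<le> e k"
  shows "e \<longlonglongrightarrow> 0" and "V k \<le> V 0"
proof -
  have dec: "decseq V"
    unfolding decseq_Suc_iff using assms by (smt (verit))
  then show "V k \<le> V 0"
    by (simp add: decseqD)
  obtain L where L: "V \<longlonglongrightarrow> L"
    using decseq_convergent[OF dec, of 0] assms(2) by blast
  have "(\<lambda>k. V k - V (Suc k)) \<longlonglongrightarrow> 0"
    using tendsto_diff[OF L LIMSEQ_Suc[OF L]] by simp
  moreover have "\<forall>\<^sub>F k in sequentially. norm (e k) \<le> V k - V (Suc k)"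
  proof (intro always_eventually allI)
    fix k
    show "norm (e k) \<le> V k - V (Suc k)"
      using descent[of k] assms(3)[of k] by simp
  qed
  ultimately show "e \<longlonglongrightarrow> 0"
    by (rule Lim_null_comparison[rotated])
qed

lemma tendsto_0_if_power2_norm_le:
  fixes a :: "nat \<Rightarrow> 'a::real_normed_vector"
  assumes "\<And>k. (norm (a k))\<^sup>2 \<le> e k" and "e \<longlonglongrightarrow> 0"
  shows "a \<longlonglongrightarrow> 0"
proof -
  have "(\<lambda>k. (norm (a k))\<^sup>2) \<longlonglongrightarrow> 0"
    by (rule Lim_null_comparison[OF _ assms(2)]) (simp add: assms(1))
  then have "(\<lambda>k. norm (a k)) \<longlonglongrightarrow> 0"
    by (simp add: power_tendsto_0_iff)
  then show ?thesis
    by (simp add: tendsto_norm_zero_iff)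
qed

text \<open>The three-point identity turns the inner products of the optimality inequalities into
  differences of squared distances, which telescope.\<close>

lemma inner_step:
  fixes a b c :: "'a::real_inner"
  shows "2 * ((b - c) \<bullet> (b - a)) = (norm (b - c))\<^sup>2 - (norm (a - c))\<^sup>2 + (norm (b - a))\<^sup>2"
  unfolding power2_norm_eq_inner by (simp add: algebra_simps inner_commute)

text \<open>The convergence argument with the primal variables abstracted away: \<open>F\<close> is the objective,
  \<open>s\<close> and \<open>r\<close> are the residuals of \<open>g\<close> and \<open>h\<close>, and \<open>b\<close> stands for \<open>h2 z\<close>. Nothing is
  assumed about the signs of the cross terms of the very first step, as \<open>z\<^sup>0\<close> is not a minimizer.\<close>

lemma admm_residual_convergence:
  fixes F :: "nat \<Rightarrow> real" and Fs \<rho> :: real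
    and s \<mu> :: "nat \<Rightarrow> 'p::real_inner" and r b \<nu> :: "nat \<Rightarrow> 'm::real_inner"
  assumes "\<rho> > 0"
    and \<mu>: "\<And>k. \<mu> (Suc k) = \<mu> k + \<rho> *\<^sub>R s (Suc k)"
    and \<nu>: "\<And>k. \<nu> (Suc k) = \<nu> k + \<rho> *\<^sub>R r (Suc k)"
    and upper: "\<And>k. F (Suc k) - Fs \<le> - (\<mu> (Suc k) \<bullet> s (Suc k)) - \<nu> (Suc k) \<bullet> r (Suc k)
                  - \<rho> * ((b (Suc k) - b k) \<bullet> (b (Suc k) - bs - r (Suc k)))"
    and lower: "\<And>k. Fs \<le> F (Suc k) + \<mu>s \<bullet> s (Suc k) + \<nu>s \<bullet> r (Suc k)"
    and cross: "\<And>k. (b (Suc (Suc k)) - b (Suc k)) \<bullet> r (Suc (Suc k)) \<le> 0"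
  shows "s \<longlonglongrightarrow> 0" and "r \<longlonglongrightarrow> 0" and "F \<longlonglongrightarrow> Fs"
proof -
  \<comment> \<open>The index starts at \<open>Suc k\<close> because \<open>cross\<close> only
    covers steps whose starting point is already a minimizer.\<close>
  define V where "V k = (norm (\<mu> (Suc k) - \<mu>s))\<^sup>2 + (norm (\<nu> (Suc k) - \<nu>s))\<^sup>2
      + \<rho>\<^sup>2 * (norm (b (Suc k) - bs))\<^sup>2" for k
  define e where "e k = \<rho>\<^sup>2 * ((norm (s (Suc (Suc k))))\<^sup>2 + (norm (r (Suc (Suc k))))\<^sup>2
      + (norm (b (Suc (Suc k)) - b (Suc k)))\<^sup>2)" for k
  have descent: "V (Suc k) + e k \<le> V k" for k
  proof -
    let ?n = "Suc k" let ?m = "Suc ?n"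
    \<comment> \<open>Adding \<open>upper\<close> and \<open>lower\<close> cancels both the
      objective and \<open>Fs\<close>.\<close>
    have gap: "(\<mu> ?m - \<mu>s) \<bullet> s ?m + (\<nu> ?m - \<nu>s) \<bullet> r ?m
        + \<rho> * ((b ?m - bs) \<bullet> (b ?m - b ?n)) - \<rho> * ((b ?m - b ?n) \<bullet> r ?m) \<le> 0"
      using upper[of ?n] lower[of ?n] by (simp add: algebra_simps inner_commute)
    have "\<rho> * ((b ?m - b ?n) \<bullet> r ?m) \<le> 0"
      using cross[of k] \<open>\<rho> > 0\<close> by (simp add: mult_le_0_iff)
    with gap have "(\<mu> ?m - \<mu>s) \<bullet> s ?m + (\<nu> ?m - \<nu>s) \<bullet> r ?m
        + \<rho> * ((b ?m - bs) \<bullet> (b ?m - b ?n)) \<le> 0"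
      by linarith
    \<comment> \<open>The factor \<open>2 * \<rho>\<close> turns the scaled residuals into
      multiplier increments, so that \<open>inner_step\<close> applies to all three terms.\<close>
    then have "(2 * \<rho>) * ((\<mu> ?m - \<mu>s) \<bullet> s ?m + (\<nu> ?m - \<nu>s) \<bullet> r ?m
        + \<rho> * ((b ?m - bs) \<bullet> (b ?m - b ?n))) \<le> 0"
      using \<open>\<rho> > 0\<close> by (simp add: mult_le_0_iff)
    then have *: "2 * ((\<mu> ?m - \<mu>s) \<bullet> (\<rho> *\<^sub>R s ?m)) + 2 * ((\<nu> ?m - \<nu>s) \<bullet> (\<rho> *\<^sub>R r ?m))
        + \<rho>\<^sup>2 * (2 * ((b ?m - bs) \<bullet> (b ?m - b ?n))) \<le> 0"
      by (simp add: algebra_simps power2_eq_square)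
    have s: "\<rho> *\<^sub>R s ?m = \<mu> ?m - \<mu> ?n" and r: "\<rho> *\<^sub>R r ?m = \<nu> ?m - \<nu> ?n"
      by (simp_all add: \<mu>[of ?n] \<nu>[of ?n])
    have "\<rho>\<^sup>2 * (norm (s ?m))\<^sup>2 = (norm (\<mu> ?m - \<mu> ?n))\<^sup>2"
      "\<rho>\<^sup>2 * (norm (r ?m))\<^sup>2 = (norm (\<nu> ?m - \<nu> ?n))\<^sup>2"
      unfolding s[symmetric] r[symmetric] by (simp_all add: power_mult_distrib)
    with * show ?thesis
      unfolding s r inner_step V_def e_def by (simp add: algebra_simps)
  qed
  have nonneg: "0 \<le> V k" "0 \<le> e k" for k
    unfolding V_def e_def by simp_all
  note Lyapunov = Lyapunov_descent[of V e, OF descent nonneg]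
  have e: "(\<lambda>k. e k / \<rho>\<^sup>2) \<longlonglongrightarrow> 0"
    using tendsto_divide_zero[OF Lyapunov(1)] .
  have "(norm (s (Suc (Suc k))))\<^sup>2 \<le> e k / \<rho>\<^sup>2" "(norm (r (Suc (Suc k))))\<^sup>2 \<le> e k / \<rho>\<^sup>2"
    "(norm (b (Suc (Suc k)) - b (Suc k)))\<^sup>2 \<le> e k / \<rho>\<^sup>2" for k
    unfolding e_def using \<open>\<rho> > 0\<close> by simp_all
  then have s: "(\<lambda>k. s (Suc (Suc k))) \<longlonglongrightarrow> 0" and r: "(\<lambda>k. r (Suc (Suc k))) \<longlonglongrightarrow> 0"
    and b: "(\<lambda>k. b (Suc (Suc k)) - b (Suc k)) \<longlonglongrightarrow> 0"
    by (auto intro: tendsto_0_if_power2_norm_le[OF _ e])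
  show "s \<longlonglongrightarrow> 0" "r \<longlonglongrightarrow> 0"
    by (rule LIMSEQ_imp_Suc[OF LIMSEQ_imp_Suc], fact s r)+
  define M where "M = sqrt (V 0)"
  have \<mu>_bound: "norm (\<mu> (Suc k) - \<mu>s) \<le> M" and \<nu>_bound: "norm (\<nu> (Suc k) - \<nu>s) \<le> M"
    and b_bound: "norm (\<rho> *\<^sub>R (b (Suc k) - bs)) \<le> M" for k
  proof -
    have "V k \<le> V 0"
      by (rule Lyapunov(2))
    then have "(norm (\<mu> (Suc k) - \<mu>s))\<^sup>2 \<le> V 0" "(norm (\<nu> (Suc k) - \<nu>s))\<^sup>2 \<le> V 0"
      "(norm (\<rho> *\<^sub>R (b (Suc k) - bs)))\<^sup>2 \<le> V 0"
      unfolding V_def[of k] norm_scaleR power_mult_distrib power2_abs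
      by (smt (verit) zero_le_power2 mult_nonneg_nonneg)+
    then show "norm (\<mu> (Suc k) - \<mu>s) \<le> M" "norm (\<nu> (Suc k) - \<nu>s) \<le> M"
      "norm (\<rho> *\<^sub>R (b (Suc k) - bs)) \<le> M"
      unfolding M_def by (simp_all add: real_le_rsqrt)
  qed
  \<comment> \<open>Recentring the multipliers in \<open>upper\<close> at \<open>\<mu>s\<close> and
    \<open>\<nu>s\<close> bounds \<open>F - Fs\<close> by \<open>lo - gap\<close> from above, while
    \<open>lower\<close> gives \<open>lo\<close> from below. Each product in \<open>gap\<close>
    pairs a bounded factor with a vanishing one.\<close>
  define lo where "lo k = - (\<mu>s \<bullet> s (Suc (Suc k))) - \<nu>s \<bullet> r (Suc (Suc k))" for k
  define gap where "gap k = (\<mu> (Suc (Suc k)) - \<mu>s) \<bullet> s (Suc (Suc k))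
      + (\<nu> (Suc (Suc k)) - \<nu>s) \<bullet> r (Suc (Suc k))
      + (\<rho> *\<^sub>R (b (Suc (Suc k)) - bs)) \<bullet> (b (Suc (Suc k)) - b (Suc k))
      - \<rho> * ((b (Suc (Suc k)) - b (Suc k)) \<bullet> r (Suc (Suc k)))" for k
  have lo: "lo \<longlonglongrightarrow> 0"
    unfolding lo_def using s r by (auto intro!: tendsto_eq_intros)
  have gap: "gap \<longlonglongrightarrow> 0"
  proof -
    have "(\<lambda>k. (\<mu> (Suc (Suc k)) - \<mu>s) \<bullet> s (Suc (Suc k))) \<longlonglongrightarrow> 0"
      "(\<lambda>k. (\<nu> (Suc (Suc k)) - \<nu>s) \<bullet> r (Suc (Suc k))) \<longlonglongrightarrow> 0"
      "(\<lambda>k. (\<rho> *\<^sub>R (b (Suc (Suc k)) - bs)) \<bullet> (b (Suc (Suc k)) - b (Suc k))) \<longlonglongrightarrow> 0"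
      by (rule tendsto_inner_bounded_0[where M = M]; fact \<mu>_bound \<nu>_bound b_bound s r b)+
    moreover have "(\<lambda>k. (b (Suc (Suc k)) - b (Suc k)) \<bullet> r (Suc (Suc k))) \<longlonglongrightarrow> 0"
      using tendsto_inner[OF b r] by simp
    then have "(\<lambda>k. \<rho> * ((b (Suc (Suc k)) - b (Suc k)) \<bullet> r (Suc (Suc k)))) \<longlonglongrightarrow> 0"
      by (rule tendsto_mult_right_zero)
    ultimately have "gap \<longlonglongrightarrow> 0 + 0 + 0 - 0"
      unfolding gap_def by (intro tendsto_add tendsto_diff)
    then show ?thesis by simp
  qed
  have "(\<lambda>k. F (Suc (Suc k)) - Fs) \<longlonglongrightarrow> 0"
  proof (rule tendsto_sandwich)
    show "\<forall>\<^sub>F k in sequentially. lo k \<le> F (Suc (Suc k)) - Fs"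
      unfolding lo_def
    proof (intro always_eventually allI)
      show "- (\<mu>s \<bullet> s (Suc (Suc k))) - \<nu>s \<bullet> r (Suc (Suc k)) \<le> F (Suc (Suc k)) - Fs" for k
        using lower[of "Suc k"] by linarith
    qed
    show "\<forall>\<^sub>F k in sequentially. F (Suc (Suc k)) - Fs \<le> lo k - gap k"
      unfolding lo_def gap_def
    proof (intro always_eventually allI, goal_cases)
      case (1 k)
      show ?case
        using upper[of "Suc k"] by (simp add: algebra_simps inner_commute)
    qed
    show "lo \<longlonglongrightarrow> 0" by (fact lo)
    show "(\<lambda>k. lo k - gap k) \<longlonglongrightarrow> 0"
      using tendsto_diff[OF lo gap] by simp
  qed
  then have "(\<lambda>k. F (Suc (Suc k))) \<longlonglongrightarrow> Fs"
    by (simp add: LIM_zero_iff)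
  then show "F \<longlonglongrightarrow> Fs"
    by (rule LIMSEQ_imp_Suc[OF LIMSEQ_imp_Suc])
qed

section \<open>First-order inequalities from convexity\<close>

text \<open>Compare the minimizer with a point at parameter \<open>t\<close> towards
  \<open>y\<close>, divide by \<open>t\<close> and let \<open>t\<close> tend to 0: the term with
  \<open>c\<close> disappears. A one-sided bound on \<open>\<phi>\<close> suffices, which is what a
  convex constraint provides.\<close>

lemma ext_convex_first_order:
  fixes f :: "'a::real_vector \<Rightarrow> ereal" and \<phi> :: "'a \<Rightarrow> real"
  assumes "ext_convex f" and "f x \<noteq> \<infinity>"
    and min: "\<And>w. f x + ereal (\<phi> x) \<le> f w + ereal (\<phi> w)"
    and \<phi>: "\<And>t. 0 < t \<Longrightarrow> t \<le> 1 \<Longrightarrow> \<phi> ((1 - t) *\<^sub>R x + t *\<^sub>R y) \<le> \<phi> x + t * d + t\<^sup>2 * c"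
  shows "f x \<le> f y + ereal d"
proof (cases "f y")
  case (real b)
  obtain a where a: "f x = ereal a"
    using assms(1,2) unfolding ext_convex_def by (cases "f x") auto
  have "a \<le> b + d + t * c" if t: "0 < t" "t \<le> 1" for t
  proof -
    let ?w = "(1 - t) *\<^sub>R x + t *\<^sub>R y"
    have "f ?w \<le> ereal (1 - t) * f x + ereal t * f y"
      using assms(1) t unfolding ext_convex_def by simp
    then have w: "f ?w \<le> ereal ((1 - t) * a + t * b)"
      by (simp add: a real)
    have "ereal (a + \<phi> x) \<le> f ?w + ereal (\<phi> ?w)"
      using min[of ?w] a by simp
    also have "\<dots> \<le> ereal ((1 - t) * a + t * b) + ereal (\<phi> x + t * d + t\<^sup>2 * c)"
      using w \<phi>[OF t] by (intro add_mono) simp_all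
    finally have "t * a \<le> t * (b + d + t * c)"
      by (simp add: algebra_simps power2_eq_square)
    with t show ?thesis by simp
  qed
  then have "\<forall>\<^sub>F t in at_right 0. a \<le> b + d + t * c"
    unfolding eventually_at_right_field by (intro exI[of _ 1]) auto
  moreover have "((\<lambda>t. b + d + t * c) \<longlongrightarrow> b + d) (at_right 0)"
    by (auto intro!: tendsto_eq_intros)
  ultimately have "a \<le> b + d"
    by (intro tendsto_lowerbound[where F = "at_right 0"]) auto
  with a real show ?thesis by simp
\<comment> \<open>For \<open>f y = \<infinity>\<close> the bound is trivial, and
  \<open>-\<infinity>\<close> is excluded.\<close>
qed (use assms(1) in \<open>auto simp: ext_convex_def\<close>)

lemma affine_map_segment:
  assumes "affine_map h"
  shows "h ((1 - t) *\<^sub>R x + t *\<^sub>R y) = h x + t *\<^sub>R (h y - h x)"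
proof -
  obtain A b where h: "\<And>x. h x = A *v x + b"
    using assms unfolding affine_map_def by blast
  show ?thesis
    unfolding h by (simp add: matrix_vector_right_distrib matrix_vector_mult_scaleR algebra_simps)
qed

text \<open>Clipping at 0 preserves convexity and leads to the range where squaring is increasing;
  the square itself falls below its chord by \<open>t * (1 - t) * (?p - ?q)\<^sup>2\<close>.\<close>

lemma convex_on_max_0_square:
  fixes u :: "'a::real_vector \<Rightarrow> real"
  assumes "convex_on UNIV u" and t: "0 \<le> t" "t \<le> 1"
  shows "(max 0 (u ((1 - t) *\<^sub>R x + t *\<^sub>R y)))\<^sup>2 \<le> (1 - t) * (max 0 (u x))\<^sup>2 + t * (max 0 (u y))\<^sup>2"
proof -
  let ?p = "max 0 (u x)" and ?q = "max 0 (u y)"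
  have "u ((1 - t) *\<^sub>R x + t *\<^sub>R y) \<le> (1 - t) * u x + t * u y"
    using convex_onD[OF assms(1) t] by simp
  also have "\<dots> \<le> (1 - t) * ?p + t * ?q"
    using t by (intro add_mono mult_left_mono) auto
  finally have "max 0 (u ((1 - t) *\<^sub>R x + t *\<^sub>R y)) \<le> (1 - t) * ?p + t * ?q"
    using t by simp
  then have "(max 0 (u ((1 - t) *\<^sub>R x + t *\<^sub>R y)))\<^sup>2 \<le> ((1 - t) * ?p + t * ?q)\<^sup>2"
    by (intro power_mono) auto
  also have "\<dots> \<le> (1 - t) * ?p\<^sup>2 + t * ?q\<^sup>2"
  proof -
    have "(1 - t) * ?p\<^sup>2 + t * ?q\<^sup>2 - ((1 - t) * ?p + t * ?q)\<^sup>2 = t * (1 - t) * (?p - ?q)\<^sup>2"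
      by (simp add: algebra_simps power2_eq_square)
    moreover have "0 \<le> t * (1 - t) * (?p - ?q)\<^sup>2"
      using t by simp
    ultimately show ?thesis by linarith
  qed
  finally show ?thesis .
qed

section \<open>The penalty of one constraint block\<close>

definition penalty :: "real \<Rightarrow> 'a::real_inner \<Rightarrow> 'a \<Rightarrow> real" where
  "penalty \<rho> \<mu> v = \<rho> / 2 * (norm v)\<^sup>2 + \<mu> \<bullet> v"

text \<open>The expansion is exact, and its linear coefficient
  \<open>\<mu> + \<rho> *\<^sub>R v\<close> has the form of a multiplier update with residual
  \<open>v\<close>.\<close>

lemma penalty_segment:
  "penalty \<rho> \<mu> (v + t *\<^sub>R w) =
     penalty \<rho> \<mu> v + t * ((\<mu> + \<rho> *\<^sub>R v) \<bullet> w) + t\<^sup>2 * (\<rho> / 2 * (norm w)\<^sup>2)"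
  unfolding penalty_def power2_norm_eq_inner
  by (simp add: algebra_simps inner_commute power2_eq_square)

text \<open>Allows \<open>g\<close> on a segment to be replaced by its chord. Componentwise,
  squaring is increasing on nonnegative reals and the linear term has nonnegative
  coefficients.\<close>

lemma penalty_mono:
  fixes \<mu> v w :: "real ^ 'p"
  assumes "0 \<le> \<rho>" and "\<And>i. 0 \<le> \<mu> $ i" and "\<And>i. 0 \<le> v $ i" and "\<And>i. v $ i \<le> w $ i"
  shows "penalty \<rho> \<mu> v \<le> penalty \<rho> \<mu> w"
  unfolding penalty_def power2_norm_eq_inner inner_vec_def
  using assms
  by (intro add_mono mult_left_mono sum_mono) (auto intro!: mult_mono order_trans[OF assms(3,4)])

lemma aug_lagrangian_penalty:
  "aug_lagrangian f1 f2 g h1 h2 \<rho> x z \<mu> \<nu> =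
     f1 x + f2 z + ereal (penalty \<rho> \<mu> (g x) + penalty \<rho> \<nu> (h1 x + h2 z))"
  unfolding aug_lagrangian_def penalty_def by (simp add: add.assoc)

section \<open>Application to the iterates\<close>

theorem theorem1:
  fixes f1 :: "real ^ 'n1 \<Rightarrow> ereal" and f2 :: "real ^ 'n2 \<Rightarrow> ereal"
    and g0 g :: "real ^ 'n1 \<Rightarrow> real ^ 'p"
    and h1 :: "real ^ 'n1 \<Rightarrow> real ^ 'm" and h2 :: "real ^ 'n2 \<Rightarrow> real ^ 'm"
    and xs :: "real ^ 'n1" and zs :: "real ^ 'n2"
    and \<mu>s :: "real ^ 'p" and \<nu>s :: "real ^ 'm"
    and \<rho> :: real
    and x :: "nat \<Rightarrow> real ^ 'n1" and z :: "nat \<Rightarrow> real ^ 'n2"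
    and \<mu> :: "nat \<Rightarrow> real ^ 'p" and \<nu> :: "nat \<Rightarrow> real ^ 'm"
  assumes "ext_convex f1" and "ext_convex f2"
    and "\<And>i. convex_on UNIV (\<lambda>y. g0 y $ i)"
    and "affine_map h1" and "affine_map h2"
    and "\<And>y. g y = (\<chi> i. (max 0 (g0 y $ i))\<^sup>2)"
    and "(xs, zs) \<in> feasible_set g h1 h2"
    and "f1 xs + f2 zs = opt_value f1 f2 g h1 h2"
    and "\<bar>opt_value f1 f2 g h1 h2\<bar> \<noteq> \<infinity>"
    and "\<And>y w. aug_lagrangian f1 f2 g h1 h2 0 xs zs \<mu>s \<nu>s
                \<le> aug_lagrangian f1 f2 g h1 h2 0 y w \<mu>s \<nu>s"
    and "\<rho> > 0"
    and "admm_iterates f1 f2 g h1 h2 \<rho> x z \<mu> \<nu>"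
  shows "(\<lambda>k. g (x k)) \<longlonglongrightarrow> 0 \<and>
         (\<lambda>k. h1 (x k) + h2 (z k)) \<longlonglongrightarrow> 0 \<and>
         (\<lambda>k. f1 (x k) + f2 (z k)) \<longlonglongrightarrow> opt_value f1 f2 g h1 h2"
proof -
  note convex1 = assms(1) and convex2 = assms(2) and affine1 = assms(4) and affine2 = assms(5)
    and g_eq = assms(6) and saddle = assms(10) and \<rho> = \<open>\<rho> > 0\<close>
  have feasible: "g xs = 0" "h1 xs + h2 zs = 0"
    using assms(7) by (simp_all add: feasible_set_def)
  have x_min: "aug_lagrangian f1 (\<lambda>_. 0) g h1 h2 \<rho> (x (Suc k)) (z k) (\<mu> k) (\<nu> k)
        \<le> aug_lagrangian f1 (\<lambda>_. 0) g h1 h2 \<rho> y (z k) (\<mu> k) (\<nu> k)"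
    and z_min: "aug_lagrangian f1 f2 g h1 h2 \<rho> (x (Suc k)) (z (Suc k)) (\<mu> k) (\<nu> k)
        \<le> aug_lagrangian f1 f2 g h1 h2 \<rho> (x (Suc k)) w (\<mu> k) (\<nu> k)"
    and \<mu>_Suc: "\<mu> (Suc k) = \<mu> k + \<rho> *\<^sub>R g (x (Suc k))"
    and \<nu>_Suc: "\<nu> (Suc k) = \<nu> k + \<rho> *\<^sub>R (h1 (x (Suc k)) + h2 (z (Suc k)))"
    and "\<mu> 0 = 0" for k y w
    using assms(12) unfolding admm_iterates_def is_arg_min_linorder by auto
  have g_nonneg: "0 \<le> g y $ i" for y i
    by (simp add: g_eq)
  have \<mu>_nonneg: "0 \<le> \<mu> k $ i" for k i
    by (induction k) (use \<rho> g_nonneg in \<open>simp_all add: \<open>\<mu> 0 = 0\<close> \<mu>_Suc\<close>)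
  have not_MInf: "f1 y \<noteq> -\<infinity>" "f2 w \<noteq> -\<infinity>" for y w
    using convex1 convex2 unfolding ext_convex_def by auto
  have "\<bar>f1 xs + f2 zs\<bar> \<noteq> \<infinity>"
    using assms(8,9) by simp
  then obtain f1s f2s where fs: "f1 xs = ereal f1s" "f2 zs = ereal f2s"
    using not_MInf by (cases "f1 xs"; cases "f2 zs") auto
  \<comment> \<open>The minimizer is compared with \<open>xs\<close>, where the objective is finite.
    The starting point is no minimizer, so \<open>f1 (x 0)\<close> may be infinite.\<close>
  have f1_finite: "f1 (x (Suc k)) \<noteq> \<infinity>" for k
    using x_min[of k xs] unfolding aug_lagrangian_penalty fs by auto
  \<comment> \<open>At index 0 an infinite value becomes the default 0; only successor indices are
    converted back to \<open>f1\<close>.\<close>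
  define F1 where "F1 k = real_of_ereal (f1 (x k))" for k
  have F1: "f1 (x (Suc k)) = ereal (F1 (Suc k))" for k
    unfolding F1_def using f1_finite[of k] not_MInf(1)[of "x (Suc k)"] by (auto simp: ereal_real)
  have f2_finite: "f2 (z (Suc k)) \<noteq> \<infinity>" for k
    using z_min[of k zs] unfolding aug_lagrangian_penalty fs F1 by auto
  define F2 where "F2 k = real_of_ereal (f2 (z k))" for k
  have F2: "f2 (z (Suc k)) = ereal (F2 (Suc k))" for k
    unfolding F2_def using f2_finite[of k] not_MInf(2)[of "z (Suc k)"] by (auto simp: ereal_real)
  define b where "b k = h2 (z k)" for k
  define r where "r k = h1 (x k) + h2 (z k)" for k
  \<comment> \<open>The update of \<open>x\<close> still sees the old \<open>z k\<close>, so its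
    effective multiplier \<open>\<nu> k + \<rho> *\<^sub>R (h1 (x (Suc k)) + h2 (z k))\<close>
    differs from \<open>\<nu> (Suc k)\<close> by
    \<open>\<rho> *\<^sub>R (b (Suc k) - b k)\<close>.\<close>
  have x_step: "f1 (x (Suc k)) \<le> f1 y + ereal (\<mu> (Suc k) \<bullet> (g y - g (x (Suc k)))
      + (\<nu> (Suc k) - \<rho> *\<^sub>R (b (Suc k) - b k)) \<bullet> (h1 y - h1 (x (Suc k))))" for k y
  proof (rule ext_convex_first_order[where \<phi> = "\<lambda>y. penalty \<rho> (\<mu> k) (g y)
        + penalty \<rho> (\<nu> k) (h1 y + h2 (z k))"])
    let ?x = "x (Suc k)" let ?D = "g y - g ?x" and ?E = "h1 y - h1 ?x"
    fix t :: real
    assume t: "0 < t" "t \<le> 1"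
    let ?w = "(1 - t) *\<^sub>R ?x + t *\<^sub>R y"
    have "penalty \<rho> (\<mu> k) (g ?w) \<le> penalty \<rho> (\<mu> k) (g ?x + t *\<^sub>R ?D)"
    proof (rule penalty_mono)
      show "g ?w $ i \<le> (g ?x + t *\<^sub>R ?D) $ i" for i
        using convex_on_max_0_square[OF assms(3), of t ?x y i] t
        by (simp add: g_eq algebra_simps)
    qed (use \<rho> \<mu>_nonneg g_nonneg in auto)
    moreover have "h1 ?w + h2 (z k) = (h1 ?x + h2 (z k)) + t *\<^sub>R ?E"
      by (simp add: affine_map_segment[OF affine1])
    then have "penalty \<rho> (\<nu> k) (h1 ?w + h2 (z k))
        = penalty \<rho> (\<nu> k) ((h1 ?x + h2 (z k)) + t *\<^sub>R ?E)"
      by (rule arg_cong)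
    moreover have "\<nu> (Suc k) - \<rho> *\<^sub>R (b (Suc k) - b k) = \<nu> k + \<rho> *\<^sub>R (h1 ?x + h2 (z k))"
      by (simp add: \<nu>_Suc b_def algebra_simps)
    ultimately show "penalty \<rho> (\<mu> k) (g ?w) + penalty \<rho> (\<nu> k) (h1 ?w + h2 (z k))
        \<le> penalty \<rho> (\<mu> k) (g ?x) + penalty \<rho> (\<nu> k) (h1 ?x + h2 (z k))
          + t * (\<mu> (Suc k) \<bullet> ?D + (\<nu> (Suc k) - \<rho> *\<^sub>R (b (Suc k) - b k)) \<bullet> ?E)
          + t\<^sup>2 * (\<rho> / 2 * (norm ?D)\<^sup>2 + \<rho> / 2 * (norm ?E)\<^sup>2)"
      by (simp add: penalty_segment \<mu>_Suc distrib_left)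
  qed (use convex1 f1_finite x_min in \<open>simp_all add: aug_lagrangian_penalty\<close>)
  \<comment> \<open>Here both primal variables are current, so the effective multiplier is exactly
    \<open>\<nu> (Suc k)\<close>.\<close>
  have z_step: "f2 (z (Suc k)) \<le> f2 w + ereal (\<nu> (Suc k) \<bullet> (h2 w - b (Suc k)))" for k w
  proof (rule ext_convex_first_order[where \<phi> = "\<lambda>w. penalty \<rho> (\<nu> k) (h1 (x (Suc k)) + h2 w)"])
    let ?z = "z (Suc k)" let ?E = "h2 w - b (Suc k)"
    fix v
    show "f2 ?z + ereal (penalty \<rho> (\<nu> k) (h1 (x (Suc k)) + h2 ?z))
        \<le> f2 v + ereal (penalty \<rho> (\<nu> k) (h1 (x (Suc k)) + h2 v))"
      using z_min[of k v] unfolding aug_lagrangian_penalty F1 F2 by (cases "f2 v") auto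
  next
    fix t :: real
    let ?z = "z (Suc k)" let ?E = "h2 w - b (Suc k)"
    let ?w = "(1 - t) *\<^sub>R ?z + t *\<^sub>R w"
    have "h1 (x (Suc k)) + h2 ?w = (h1 (x (Suc k)) + h2 ?z) + t *\<^sub>R ?E"
      by (simp add: affine_map_segment[OF affine2] b_def)
    then have "penalty \<rho> (\<nu> k) (h1 (x (Suc k)) + h2 ?w)
        = penalty \<rho> (\<nu> k) ((h1 (x (Suc k)) + h2 ?z) + t *\<^sub>R ?E)"
      by (rule arg_cong)
    then show "penalty \<rho> (\<nu> k) (h1 (x (Suc k)) + h2 ?w)
        \<le> penalty \<rho> (\<nu> k) (h1 (x (Suc k)) + h2 ?z) + t * (\<nu> (Suc k) \<bullet> ?E)
          + t\<^sup>2 * (\<rho> / 2 * (norm ?E)\<^sup>2)"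
      by (simp add: penalty_segment \<nu>_Suc)
  qed (use convex2 f2_finite in simp_all)
  have h1_eq: "h1 (x k) = r k - b k" for k
    by (simp add: r_def b_def)
  have h1s: "h1 xs = - h2 zs"
    using feasible(2) by (simp add: eq_neg_iff_add_eq_0)
  \<comment> \<open>Both steps are tested at the optimum; there
    \<open>h1 xs - h1 (x (Suc k))\<close> equals
    \<open>b (Suc k) - h2 zs - r (Suc k)\<close>.\<close>
  have upper: "(F1 (Suc k) + F2 (Suc k)) - (f1s + f2s)
      \<le> - (\<mu> (Suc k) \<bullet> g (x (Suc k))) - \<nu> (Suc k) \<bullet> r (Suc k)
        - \<rho> * ((b (Suc k) - b k) \<bullet> (b (Suc k) - h2 zs - r (Suc k)))" for k
    using x_step[of k xs] z_step[of k zs]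
    by (simp add: F1 F2 fs feasible(1) h1_eq h1s algebra_simps)
  have lower: "f1s + f2s \<le> F1 (Suc k) + F2 (Suc k) + \<mu>s \<bullet> g (x (Suc k)) + \<nu>s \<bullet> r (Suc k)" for k
    using saddle[of "x (Suc k)" "z (Suc k)"]
    by (simp add: aug_lagrangian_def F1 F2 fs feasible r_def algebra_simps)
  \<comment> \<open>Monotonicity argument: two consecutive minimizers in \<open>z\<close> are tested
    against each other and the inequalities added, which cancels \<open>F2\<close>.\<close>
  have cross: "(b (Suc (Suc k)) - b (Suc k)) \<bullet> r (Suc (Suc k)) \<le> 0" for k
  proof -
    have "0 \<le> (\<nu> (Suc (Suc k)) - \<nu> (Suc k)) \<bullet> (b (Suc k) - b (Suc (Suc k)))"
      using z_step[of "Suc k" "z (Suc k)"] z_step[of k "z (Suc (Suc k))"]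
      by (simp add: F2 b_def[symmetric] algebra_simps)
    also have "\<dots> = - \<rho> * ((b (Suc (Suc k)) - b (Suc k)) \<bullet> r (Suc (Suc k)))"
      by (simp add: \<nu>_Suc[of "Suc k"] r_def[symmetric] algebra_simps inner_commute)
    finally show ?thesis
      using \<rho> by (simp add: mult_le_0_iff)
  qed
  note limits = admm_residual_convergence[where F = "\<lambda>k. F1 k + F2 k" and s = "\<lambda>k. g (x k)",
      OF \<rho> \<mu>_Suc \<nu>_Suc[folded r_def] upper lower cross]
  have "(\<lambda>k. ereal (F1 (Suc k) + F2 (Suc k))) \<longlonglongrightarrow> ereal (f1s + f2s)"
    using LIMSEQ_Suc[OF limits(3)] by (rule tendsto_ereal)
  then have "(\<lambda>k. f1 (x (Suc k)) + f2 (z (Suc k))) \<longlonglongrightarrow> opt_value f1 f2 g h1 h2"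
    by (simp add: F1 F2 fs flip: assms(8))
  \<comment> \<open>A possibly infinite value at index 0 does not affect the limit.\<close>
  then have "(\<lambda>k. f1 (x k) + f2 (z k)) \<longlonglongrightarrow> opt_value f1 f2 g h1 h2"
    by (rule LIMSEQ_imp_Suc)
  with limits(1,2) show ?thesis
    unfolding r_def by blast
qed

end
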